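(* Let $F:\mathbb R^2\to\mathbb R$ be a $\mathcal C^2$ function with bounded derivatives. If an $L$-ball weighted least squares subdivision scheme converges for any data attached to $T^0$, then it has second order of approximation, meaning that there exist constants $C_1=C_1(V^0,F)>0$ and $h_0=h_0(V^0,F)>0$ such that $$\left\|\left(\prod_{l=0}^k S_l\right)F_0-F_{k+1}\right\|_\infty\le C_1h^2,\qquad \forall\, 0<h<h_0,\ \forall k\ge0,$$ where $\prod_{l=0}^kS_l=S_kS_{k-1}\cdots S_0$.
   Context: Triangulations. $T^0=(V^0,E^0)$ is a triangulation in the plane with vertices $V^0=\{\mathbf v^0_1,\dots,\mathbf v^0_{N^0}\}\subset\mathbb R^2$ and edges $E^0\subset\{1,\dots,N^0\}^2$ ($(i,j)\in E^0$ means that $\mathbf v^0_i,\mathbf v^0_j$ are connected by an edge); faces are non-degenerate triangles and every vertex and edge belongs to a face. $T^{k+1}=(V^{k+1},E^{k+1})$ is obtained from $T^k$ by adding the mid-point of every edge and splitting every face into four similar faces; thus each $\mathbf v^{k+1}_\ell\in V^{k+1}$, $\ell=1,\dots,N^{k+1}$, is either a vertex or an edge mid-point of $T^k$. Scheme. Fix $L>\sup\{\|\mathbf v^0_i-\mathbf v^0_j\|:(i,j)\in E^0\}$ (Euclidean norm) and a weight function $W:[0,1)\to(0,1]$. Let $\Pi_1$ be the space of bivariate polynomials of degree at most $1$. For $k\ge0$, $\ell=1,\dots,N^{k+1}$, put $$\mathcal B^{k+1,\ell}=\{j\in\{1,\dots,N^k\}:\|\mathbf v^k_j-\mathbf v^{k+1}_\ell\|<2^{-k}L\},\qquad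 w^{k+1,\ell}_i=W\!\left(\frac{\|\mathbf v^{k+1}_\ell-\mathbf v^k_i\|}{2^{-k}L}\right),\ i\in\mathcal B^{k+1,\ell}.$$ Given data $\mathbf z^k=(z^k_j)_{j=1}^{N^k}$ attached to $V^k$, the new datum $z^{k+1}_\ell$ is $\hat p(\mathbf v^{k+1}_\ell)$, where $\hat p\in\Pi_1$ minimizes $\sum_{i\in\mathcal B^{k+1,\ell}}w^{k+1,\ell}_i\,(p(\mathbf v^k_i)-z^k_i)^2$ over $p\in\Pi_1$. Explicitly, $$z^{k+1}_\ell=\sum_{i\in\mathcal B^{k+1,\ell}}\alpha^{k+1,\ell}_i z^k_i,\qquad \alpha^{k+1,\ell}_i=\frac{w^{k+1,\ell}_i\mu^{k+1,\ell}_i}{\sum_{j\in\mathcal B^{k+1,\ell}}w^{k+1,\ell}_j\mu^{k+1,\ell}_j},$$ $$\mu^{k+1,\ell}_i=\sum_{\substack{j_1,j_2\in\mathcal B^{k+1,\ell}\\ j_1<j_2}}w^{k+1,\ell}_{j_1}w^{k+1,\ell}_{j_2}\begin{vmatrix}1&1&1\\ \mathbf v^{k+1}_\ell&\mathbf v^k_{j_1}&\mathbf v^k_{j_2}\end{vmatrix}\begin{vmatrix}1&1&1\\ \mathbf v^k_i&\mathbf v^k_{j_1}&\mathbf v^k_{j_2}\end{vmatrix},$$ where points of $\mathbb R^2$ are written as columns. The linear map $\mathbf z^k\mapsto\mathbf z^{k+1}$, $\mathbb R^{N^k}\to\mathbb R^{N^{k+1}}$, is denoted $S_k$. Scaling.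 For $h>0$, $T^k_h=(hV^k,E^k)$ is the triangulation $T^k$ with all vertices scaled by $h$; on the scaled triangulation the parameter $L$ is replaced by $hL$, and then the operator is the same $S_k$ for every $h$. For a function $F$ on $\mathbb R^2$, $F_k=F|_{hV^k}=(F(h\mathbf v^k_j))_{j=1}^{N^k}$ (which depends on $h$). $\|\cdot\|_\infty$ is the maximum norm of a vector. The constants are independent of $h$ and $k$; the scheme ($L$ and $W$) and the triangulation are fixed. Convergence. The scheme converges for data $\mathbf z^0\in\mathbb R^{N^0}$ if there is a continuous $G:\mathbb R^2\to\mathbb R$ with $\lim_{k\to\infty}\sup_\ell|z^k_\ell-G(\mathbf v^k_\ell)|=0$, where $\mathbf z^{k+1}=S_k\mathbf z^k$. *)

theory Defs
  imports "HOL-Analysis.Analysis"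
begin

section \<open>Triangulations of planar point sets\<close>

type_synonym point = "real ^ 2"

text \<open>
  Vertices are identified with their positions, so no enumeration of the vertices is chosen.
  An edge is present in \<open>edges\<close> with both orientations; a face is given by the set of its
  three vertices.
\<close>

record mesh =
  verts :: "point set"
  edges :: "(point \<times> point) set"
  faces :: "point set set"

definition plane_triangulation :: "mesh \<Rightarrow> bool" where
  "plane_triangulation T \<longleftrightarrow>
     finite (verts T) \<and> verts T \<noteq> {} \<and>
     edges T \<subseteq> verts T \<times> verts T \<and> sym (edges T) \<and> irrefl (edges T) \<and>
     (\<forall>f\<in>faces T. f \<subseteq> verts T \<and> card f = 3 \<and> \<not> collinear f) \<and>
     (\<forall>f\<in>faces T. \<forall>a\<in>f. \<forall>b\<in>f. a \<noteq> b \<longrightarrow> (a, b) \<in> edges T) \<and>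
     (\<forall>v\<in>verts T. \<exists>f\<in>faces T. v \<in> f) \<and>
     (\<forall>(a, b)\<in>edges T. \<exists>f\<in>faces T. a \<in> f \<and> b \<in> f) \<and>
     triangulation ((\<lambda>f. convex hull f) ` faces T)"

text \<open>
  In the set comprehensions over faces the points \<open>a\<close>, \<open>b\<close>, \<open>c\<close> are automatically distinct,
  since faces have three elements.
\<close>

definition refine :: "mesh \<Rightarrow> mesh" where
  "refine T =
     \<lparr>verts = verts T \<union> {midpoint a b | a b. (a, b) \<in> edges T},
      edges = {(a, midpoint a b) | a b. (a, b) \<in> edges T}
            \<union> {(midpoint a b, a) | a b. (a, b) \<in> edges T}
            \<union> {(midpoint a b, midpoint a c) | a b c. {a, b, c} \<in> faces T},
      faces = {{a, midpoint a b, midpoint a c} | a b c. {a, b, c} \<in> faces T}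
            \<union> {{midpoint a b, midpoint b c, midpoint c a} | a b c. {a, b, c} \<in> faces T}\<rparr>"

primrec mesh_level :: "mesh \<Rightarrow> nat \<Rightarrow> mesh" where
  "mesh_level T0 0 = T0"
| "mesh_level T0 (Suc k) = refine (mesh_level T0 k)"

section \<open>The L-ball weighted least squares scheme\<close>

definition Pi1 :: "(point \<Rightarrow> real) set" where
  "Pi1 = {p. \<exists>a b c. \<forall>x. p x = a + b * x $ 1 + c * x $ 2}"

text \<open>
  Data attached to the vertices of level \<open>k\<close> are functions on the plane of which only the values
  on \<open>verts (mesh_level T0 k)\<close> matter.
\<close>

definition ls_ball :: "mesh \<Rightarrow> real \<Rightarrow> nat \<Rightarrow> point \<Rightarrow> point set" where
  "ls_ball T0 L k v = {u \<in> verts (mesh_level T0 k). norm (u - v) < L / 2 ^ k}"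

definition ls_weight :: "real \<Rightarrow> (real \<Rightarrow> real) \<Rightarrow> nat \<Rightarrow> point \<Rightarrow> point \<Rightarrow> real" where
  "ls_weight L W k v u = W (norm (v - u) / (L / 2 ^ k))"

definition ls_error ::
    "mesh \<Rightarrow> real \<Rightarrow> (real \<Rightarrow> real) \<Rightarrow> nat \<Rightarrow> (point \<Rightarrow> real) \<Rightarrow> point \<Rightarrow> (point \<Rightarrow> real) \<Rightarrow> real" where
  "ls_error T0 L W k z v p = (\<Sum>u\<in>ls_ball T0 L k v. ls_weight L W k v u * (p u - z u)\<^sup>2)"

text \<open>
  When \<open>L\<close> exceeds all edge lengths and \<open>W\<close> is positive on \<open>[0,1)\<close>, the ball around a vertex of
  level \<open>k + 1\<close> contains the three vertices of some face of level \<open>k\<close>, so the minimizer in the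
  next definition exists and is unique.
\<close>

definition subdiv_op ::
    "mesh \<Rightarrow> real \<Rightarrow> (real \<Rightarrow> real) \<Rightarrow> nat \<Rightarrow> (point \<Rightarrow> real) \<Rightarrow> point \<Rightarrow> real" where
  "subdiv_op T0 L W k z v = (arg_min (ls_error T0 L W k z v) (\<lambda>p. p \<in> Pi1)) v"

text \<open>\<open>subdiv_iter T0 L W k\<close> is the composition of the operators of levels \<open>k - 1\<close> down to \<open>0\<close>.\<close>

primrec subdiv_iter ::
    "mesh \<Rightarrow> real \<Rightarrow> (real \<Rightarrow> real) \<Rightarrow> nat \<Rightarrow> (point \<Rightarrow> real) \<Rightarrow> point \<Rightarrow> real" where
  "subdiv_iter T0 L W 0 z = z"
| "subdiv_iter T0 L W (Suc k) z = subdiv_op T0 L W k (subdiv_iter T0 L W k z)"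

definition scheme_converges ::
    "mesh \<Rightarrow> real \<Rightarrow> (real \<Rightarrow> real) \<Rightarrow> (point \<Rightarrow> real) \<Rightarrow> bool" where
  "scheme_converges T0 L W z0 \<longleftrightarrow>
     (\<exists>G. continuous_on UNIV G \<and>
       (\<lambda>k. SUP v\<in>verts (mesh_level T0 k). \<bar>subdiv_iter T0 L W k z0 v - G v\<bar>) \<longlonglongrightarrow> 0)"

section \<open>Approximation\<close>

definition max_norm :: "point set \<Rightarrow> (point \<Rightarrow> real) \<Rightarrow> real" where
  "max_norm V z = Max ((\<lambda>v. \<bar>z v\<bar>) ` V)"

definition C2_bounded_derivs :: "(point \<Rightarrow> real) \<Rightarrow> bool" where
  "C2_bounded_derivs F \<longleftrightarrow>
     (\<exists>(F' :: point \<Rightarrow> point \<Rightarrow>\<^sub>L real) (F'' :: point \<Rightarrow> point \<Rightarrow>\<^sub>L point \<Rightarrow>\<^sub>L real).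
        (\<forall>x. (F has_derivative blinfun_apply (F' x)) (at x)) \<and>
        (\<forall>x. (F' has_derivative blinfun_apply (F'' x)) (at x)) \<and>
        continuous_on UNIV F'' \<and>
        bounded (range F') \<and> bounded (range F''))"

text \<open>
  The operators of the scheme on the triangulation scaled by \<open>h\<close> (with \<open>h * L\<close> in place of \<open>L\<close>)
  coincide with the unscaled ones, so the data \<open>F\<close> restricted to the scaled vertices are attached
  to the unscaled vertices.
\<close>

definition scaled_data :: "(point \<Rightarrow> real) \<Rightarrow> real \<Rightarrow> point \<Rightarrow> real" where
  "scaled_data F h v = F (h *\<^sub>R v)"

end

theory Submission
  imports Defs
begin

text \<open>
  Each level of the scheme is a linear operator that reproduces affine functions, hence so is every
  composition of levels. Convergence for the finitely many cardinal data on the initial vertices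
  bounds these compositions uniformly. Subtracting from the data the Taylor polynomial of \<open>F\<close> at
  the evaluation point leaves data of size \<open>O(h\<^sup>2)\<close>, because the initial vertex set is bounded.
\<close>

section \<open>Refinement\<close>

text \<open>Differences of image points are \<open>k\<close> times the original ones, so dividing by
  \<open>k\<close> carries a common direction back to \<open>S\<close>. Read contrapositively, it
  keeps refined faces nondegenerate.\<close>

lemma collinear_similar_imageD:
  fixes g :: "'a::real_vector \<Rightarrow> 'a"
  assumes "\<And>x y. g x - g y = k *\<^sub>R (x - y)" "k \<noteq> 0" "collinear (g ` S)"
  shows "collinear S"
proof -
  obtain u where u: "\<And>x y. x \<in> S \<Longrightarrow> y \<in> S \<Longrightarrow> \<exists>c. g x - g y = c *\<^sub>R u"
    using assms(3) unfolding collinear_def by blast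
  have "\<exists>c. x - y = c *\<^sub>R u" if xy: "x \<in> S" "y \<in> S" for x y
  proof -
    obtain c where "k *\<^sub>R (x - y) = c *\<^sub>R u"
      using u[OF xy] assms(1) by metis
    then have "x - y = (c / k) *\<^sub>R u"
      using assms(2) by (metis divide_inverse_commute scaleR_left.zero
          scaleR_scaleR vector_fraction_eq_iff)
    then show ?thesis by blast
  qed
  then show ?thesis
    unfolding collinear_def by blast
qed

text \<open>A corner triangle is homothetic to the coarse face with ratio 1/2 about that corner. The
  middle triangle needs ratio -1/2, so only the absolute value of \<open>k\<close> is fixed. Shape
  and size both transfer through \<open>g\<close>.\<close>

lemma faces_refineE:
  assumes "f' \<in> faces (refine T)"
  obtains f g k where "f \<in> faces T" "f' = g ` f" "\<bar>k\<bar> = 1 / 2"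
    "\<And>x y. g x - g y = k *\<^sub>R (x - y)"
proof -
  consider a b c where "{a, b, c} \<in> faces T" "f' = {a, midpoint a b, midpoint a c}"
    | a b c where "{a, b, c} \<in> faces T" "f' = {midpoint a b, midpoint b c, midpoint c a}"
    using assms by (auto simp: refine_def)
  then show ?thesis
  proof cases
    case 1
    show ?thesis
    proof (rule that[OF 1(1)])
      show "f' = midpoint a ` {a, b, c}" using 1(2) by simp
      show "midpoint a x - midpoint a y = (1 / 2) *\<^sub>R (x - y)" for x y
        by (simp add: midpoint_def algebra_simps)
    qed simp
  next
    case 2
    \<comment> \<open>The homothety of ratio -1/2 about the centroid: it sends each vertex to the
      midpoint of the opposite side.\<close>
    define g where "g x = (1 / 2) *\<^sub>R (a + b + c - x)" for x
    show ?thesis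
    proof (rule that[OF 2(1)])
      show "f' = g ` {a, b, c}" using 2(2)
        by (simp add: g_def midpoint_def insert_commute add.commute)
      show "g x - g y = (- 1 / 2) *\<^sub>R (x - y)" for x y
        by (simp add: g_def algebra_simps)
    qed simp
  qed
qed

section \<open>An invariant of meshes inherited by refinement\<close>

text \<open>The bound \<open>r\<close> halves with each refinement and so keeps pace with the ball
  radius \<open>L / 2 ^ k\<close>. Admitting \<open>x = y\<close> in the distance bound makes
  \<open>r\<close> positive once a face exists.\<close>

definition well_shaped :: "real \<Rightarrow> mesh \<Rightarrow> bool" where
  "well_shaped r T \<longleftrightarrow>
     finite (verts T) \<and>
     (\<forall>v\<in>verts T. \<exists>b c. {v, b, c} \<in> faces T) \<and>
     (\<forall>(a, b)\<in>edges T. \<exists>c. {a, b, c} \<in> faces T) \<and>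
     (\<forall>f\<in>faces T. f \<subseteq> verts T \<and> \<not> collinear f \<and>
        (\<forall>x\<in>f. \<forall>y\<in>f. norm (x - y) < r \<and> (x \<noteq> y \<longrightarrow> (x, y) \<in> edges T)))"

lemma well_shapedD:
  assumes "well_shaped r T"
  shows "finite (verts T)"
    and "v \<in> verts T \<Longrightarrow> \<exists>b c. {v, b, c} \<in> faces T"
    and "(a, b) \<in> edges T \<Longrightarrow> \<exists>c. {a, b, c} \<in> faces T"
    and "f \<in> faces T \<Longrightarrow> f \<subseteq> verts T"
    and "f \<in> faces T \<Longrightarrow> \<not> collinear f"
    and "f \<in> faces T \<Longrightarrow> x \<in> f \<Longrightarrow> y \<in> f \<Longrightarrow> norm (x - y) < r"
    and "f \<in> faces T \<Longrightarrow> x \<in> f \<Longrightarrow> y \<in> f \<Longrightarrow> x \<noteq> y \<Longrightarrow> (x, y) \<in> edges T"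
  using assms unfolding well_shaped_def by auto

lemma well_shapedI:
  assumes "finite (verts T)"
    and "\<And>v. v \<in> verts T \<Longrightarrow> \<exists>b c. {v, b, c} \<in> faces T"
    and "\<And>a b. (a, b) \<in> edges T \<Longrightarrow> \<exists>c. {a, b, c} \<in> faces T"
    and "\<And>f. f \<in> faces T \<Longrightarrow> f \<subseteq> verts T"
    and "\<And>f. f \<in> faces T \<Longrightarrow> \<not> collinear f"
    and "\<And>f x y. f \<in> faces T \<Longrightarrow> x \<in> f \<Longrightarrow> y \<in> f \<Longrightarrow> norm (x - y) < r"
    and "\<And>f x y. f \<in> faces T \<Longrightarrow> x \<in> f \<Longrightarrow> y \<in> f \<Longrightarrow> x \<noteq> y \<Longrightarrow> (x, y) \<in> edges T"
  shows "well_shaped r T"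
  using assms unfolding well_shaped_def by auto

lemma edges_faceI:
  assumes "well_shaped r T" "{a, b, c} \<in> faces T"
  shows "(a, b) \<in> edges T" "(b, c) \<in> edges T" "(a, c) \<in> edges T"
proof -
  have "a \<noteq> b" "b \<noteq> c" "a \<noteq> c"
    using well_shapedD(5)[OF assms] by (auto simp: insert_commute)
  then show "(a, b) \<in> edges T" "(b, c) \<in> edges T" "(a, c) \<in> edges T"
    using well_shapedD(7)[OF assms] by auto
qed

lemma edges_subset_verts:
  assumes "well_shaped r T"
  shows "edges T \<subseteq> verts T \<times> verts T"
  using well_shapedD(3,4)[OF assms] by fast

text \<open>Old vertices and half edges lie in corner triangles, midpoints in middle triangles, and
  each refined face is a half-size similar copy of a coarse one, so every condition is passed
  on.\<close>

lemma well_shaped_refine: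
  assumes T: "well_shaped r T"
  shows "well_shaped (r / 2) (refine T)"
proof -
  let ?R = "refine T"
  have corner: "{a, midpoint a b, midpoint a c} \<in> faces ?R"
    and middle: "{midpoint a b, midpoint b c, midpoint c a} \<in> faces ?R"
    if "{a, b, c} \<in> faces T" for a b c
    using that by (auto simp: refine_def)
  have fin: "finite (verts ?R)"
  proof -
    have "finite (edges T)"
      using edges_subset_verts[OF T] well_shapedD(1)[OF T] finite_subset by blast
    moreover have "verts ?R = verts T \<union> (\<lambda>(a, b). midpoint a b) ` edges T"
      by (auto simp: refine_def image_iff)
    ultimately show ?thesis
      using well_shapedD(1)[OF T] by simp
  qed
  have vert: "\<exists>b c. {v, b, c} \<in> faces ?R" if "v \<in> verts ?R" for v
  proof -
    consider "v \<in> verts T" | a b where "(a, b) \<in> edges T" "v = midpoint a b"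
      using \<open>v \<in> verts ?R\<close> by (auto simp: refine_def)
    then show ?thesis
    proof cases
      case 1
      then show ?thesis using well_shapedD(2)[OF T] corner by meson
    next
      case 2
      then show ?thesis using well_shapedD(3)[OF T] middle by meson
    qed
  qed
  have edge: "\<exists>z. {x, y, z} \<in> faces ?R" if "(x, y) \<in> edges ?R" for x y
  proof -
    \<comment> \<open>The unordered equation for \<open>{x, y}\<close> covers both orientations of a
      half edge at once.\<close>
    consider a b where "(a, b) \<in> edges T" "{x, y} = {a, midpoint a b}"
      | a b c where "{a, b, c} \<in> faces T" "x = midpoint a b" "y = midpoint a c"
      using \<open>(x, y) \<in> edges ?R\<close> by (auto simp: refine_def)
    then show ?thesis
    proof cases
      case 1
      then obtain c where "{a, b, c} \<in> faces T" using well_shapedD(3)[OF T] by blast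
      from corner[OF this] have "insert (midpoint a c) {x, y} \<in> faces ?R"
        unfolding 1(2) by (simp add: insert_commute)
      then have "{x, y, midpoint a c} \<in> faces ?R"
        by (simp add: insert_commute)
      then show ?thesis by blast
    next
      case 2
      from corner[OF 2(1)] show ?thesis
        unfolding 2(2,3) by (auto simp: insert_commute)
    qed
  qed
  have face: "f' \<subseteq> verts ?R \<and> (\<forall>x\<in>f'. \<forall>y\<in>f'. x \<noteq> y \<longrightarrow> (x, y) \<in> edges ?R)"
    if "f' \<in> faces ?R" for f'
  proof -
    consider a b c where "{a, b, c} \<in> faces T" "f' = {a, midpoint a b, midpoint a c}"
      | a b c where "{a, b, c} \<in> faces T" "f' = {midpoint a b, midpoint b c, midpoint c a}"
      using \<open>f' \<in> faces ?R\<close> by (auto simp: refine_def)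
    then show ?thesis
    proof cases
      case 1
      have acb: "{a, c, b} \<in> faces T" using 1(1) by (simp add: insert_commute)
      note e = edges_faceI[OF T 1(1)]
      have "(a, midpoint a b) \<in> edges ?R" "(midpoint a b, a) \<in> edges ?R"
        "(a, midpoint a c) \<in> edges ?R" "(midpoint a c, a) \<in> edges ?R"
        "(midpoint a b, midpoint a c) \<in> edges ?R" "(midpoint a c, midpoint a b) \<in> edges ?R"
        using e 1(1) acb by (auto simp: refine_def)
      moreover have "f' \<subseteq> verts ?R"
        using e well_shapedD(4)[OF T 1(1)] unfolding 1(2) by (auto simp: refine_def)
      ultimately show ?thesis unfolding 1(2) by blast
    next
      case 2
      \<comment> \<open>\<open>edges (refine T)\<close> lists midpoint pairs that share their first
        endpoint; the six orderings of the face supply the six oriented sides of the middle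
        triangle.\<close>
      have perm: "{a, c, b} \<in> faces T" "{b, a, c} \<in> faces T" "{b, c, a} \<in> faces T"
        "{c, a, b} \<in> faces T" "{c, b, a} \<in> faces T"
        using 2(1) by (simp_all add: insert_commute)
      have *: "(midpoint p q, midpoint p s) \<in> edges ?R" if "{p, q, s} \<in> faces T" for p q s
        using that by (auto simp: refine_def)
      note * [OF 2(1)] perm[THEN *]
      moreover have "f' \<subseteq> verts ?R"
        using edges_faceI[OF T 2(1)] edges_faceI[OF T perm(4)]
        unfolding 2(2) by (auto simp: refine_def)
      ultimately show ?thesis unfolding 2(2)
        by (auto simp: midpoint_sym[of b a] midpoint_sym[of c b] midpoint_sym[of c a])
    qed
  qed
  have shape: "\<not> collinear f' \<and> (\<forall>x\<in>f'. \<forall>y\<in>f'. norm (x - y) < r / 2)"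
    if "f' \<in> faces ?R" for f'
  proof -
    obtain f g k where f: "f \<in> faces T" "f' = g ` f" "\<bar>k\<bar> = 1 / 2"
      and g: "\<And>x y. g x - g y = k *\<^sub>R (x - y)"
      using faces_refineE[OF \<open>f' \<in> faces ?R\<close>] by metis
    have "k \<noteq> 0" using f(3) by auto
    then have "\<not> collinear f'"
      using collinear_similar_imageD[OF g, of f] well_shapedD(5)[OF T f(1)] f(2) by blast
    moreover have "norm (x - y) < r / 2" if "x \<in> f'" "y \<in> f'" for x y
      using that well_shapedD(6)[OF T f(1)] unfolding f(2) by (auto simp: g f(3))
    ultimately show ?thesis by blast
  qed
  show ?thesis
    using face shape by (intro well_shapedI fin vert edge) auto
qed

lemma well_shaped_mesh_level:
  assumes "well_shaped L T0"
  shows "well_shaped (L / 2 ^ k) (mesh_level T0 k)"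
proof (induction k)
  case (Suc k)
  from well_shaped_refine[OF this] show ?case by (simp add: mult.commute)
qed (simp add: assms)

section \<open>Location of refined vertices\<close>

text \<open>Midpoints do not leave a convex set. This confines all levels to one compact set that is
  independent of \<open>k\<close>.\<close>

lemma verts_mesh_level_hull:
  assumes "well_shaped L T0"
  shows "verts (mesh_level T0 k) \<subseteq> convex hull verts T0"
proof (induction k)
  case 0
  then show ?case by (simp add: hull_subset)
next
  case (Suc k)
  have "midpoint a b \<in> convex hull verts T0" if "(a, b) \<in> edges (mesh_level T0 k)" for a b
  proof -
    have "a \<in> convex hull verts T0" "b \<in> convex hull verts T0"
      using that edges_subset_verts[OF well_shaped_mesh_level[OF assms, of k]] Suc.IH by auto
    then have "closed_segment a b \<subseteq> convex hull verts T0"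
      by (simp add: closed_segment_subset)
    then show ?thesis by (auto simp: midpoint_in_closed_segment)
  qed
  then show ?case using Suc.IH by (auto simp: refine_def)
qed

text \<open>The vertex \<open>v\<close> lies in the convex hull of a coarse face. The ball of radius
  \<open>r\<close> about any vertex of that face is convex and contains the face, hence also
  \<open>v\<close>. This later supplies enough points for the fit.\<close>

lemma refine_vertex_near_face:
  assumes T: "well_shaped r T" and v: "v \<in> verts (refine T)"
  obtains f where "f \<in> faces T" "\<And>u. u \<in> f \<Longrightarrow> norm (u - v) < r"
proof -
  obtain f where f: "f \<in> faces T" "v \<in> convex hull f"
  proof -
    consider "v \<in> verts T" | a b where "(a, b) \<in> edges T" "v = midpoint a b"
      using v by (auto simp: refine_def)
    then show ?thesis
    proof cases
      case 1
      then show ?thesis using well_shapedD(2)[OF T] that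
        by (metis hull_inc insertI1)
    next
      case 2
      then obtain c where c: "{a, b, c} \<in> faces T" using well_shapedD(3)[OF T] by blast
      have "closed_segment a b \<subseteq> convex hull {a, b, c}"
        by (intro closed_segment_subset) (auto intro: hull_inc)
      then have "v \<in> convex hull {a, b, c}"
        unfolding 2(2) using midpoint_in_closed_segment by (rule subsetD)
      then show ?thesis using that c by blast
    qed
  qed
  have "norm (u - v) < r" if u: "u \<in> f" for u
  proof -
    have "f \<subseteq> ball u r"
      using well_shapedD(6)[OF T f(1) u] by (auto simp: dist_norm)
    then have "convex hull f \<subseteq> ball u r"
      by (simp add: hull_minimal)
    then show ?thesis using f(2) by (auto simp: dist_norm)
  qed
  then show ?thesis using that f(1) by blast
qed

text \<open>Starts the invariant: three-element faces become triples \<open>{a, b, c}\<close> by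
  naming the remaining vertex, and \<open>L\<close> exceeds every edge length.\<close>

lemma well_shaped_plane_triangulation:
  assumes T: "plane_triangulation T" and L: "L > (SUP (a, b)\<in>edges T. norm (a - b))"
  shows "well_shaped L T"
proof -
  have fin: "finite (verts T)" "edges T \<subseteq> verts T \<times> verts T" "irrefl (edges T)"
    and face: "f \<in> faces T \<Longrightarrow> f \<subseteq> verts T" "f \<in> faces T \<Longrightarrow> card f = 3"
      "f \<in> faces T \<Longrightarrow> \<not> collinear f"
    and pair: "f \<in> faces T \<Longrightarrow> x \<in> f \<Longrightarrow> y \<in> f \<Longrightarrow> x \<noteq> y \<Longrightarrow> (x, y) \<in> edges T"
    and verts: "x \<in> verts T \<Longrightarrow> \<exists>f\<in>faces T. x \<in> f"
    and edges: "(x, y) \<in> edges T \<Longrightarrow> \<exists>f\<in>faces T. x \<in> f \<and> y \<in> f" for f x y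
    using T by (simp_all add: plane_triangulation_def case_prod_beta Ball_def)
  have short: "norm (a - b) < L" if "(a, b) \<in> edges T" for a b
  proof -
    \<comment> \<open>Finiteness bounds the edge lengths above, without which \<open>SUP\<close>
      need not be an upper bound.\<close>
    have "finite (edges T)" using fin(1,2) by (auto intro: finite_subset)
    then have "(case (a, b) of (a, b) \<Rightarrow> norm (a - b)) \<le> (SUP (a, b)\<in>edges T. norm (a - b))"
      using that by (intro cSUP_upper bdd_above_finite) auto
    then show ?thesis using L by simp
  qed
  have third: "\<exists>c. f = {a, b, c}" if "f \<in> faces T" "a \<in> f" "b \<in> f" "a \<noteq> b" for f a b
  proof -
    have "card (f - {a, b}) = 1"
      using face(2)[OF that(1)] that(2-4) by (simp add: card_Diff_subset)
    then obtain c where "f - {a, b} = {c}" by (auto simp: card_1_singleton_iff)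
    then have "f = {a, b, c}" using that(2,3) by blast
    then show ?thesis by blast
  qed
  have other: "\<exists>b\<in>f. a \<noteq> b" if "f \<in> faces T" for f a
  proof (rule ccontr)
    assume "\<not> ?thesis"
    then have "f \<subseteq> {a}" by auto
    then have "card f \<le> 1" using card_mono[of "{a}" f] by simp
    then show False using face(2)[OF that] by simp
  qed
  have dist: "norm (x - y) < L" if "f \<in> faces T" "x \<in> f" "y \<in> f" for f x y
  proof (cases "x = y")
    case True
    \<comment> \<open>Here the claim amounts to \<open>0 < L\<close>, read off from a side of the
      face at \<open>x\<close>.\<close>
    obtain b where "b \<in> f" "x \<noteq> b" using other[OF \<open>f \<in> faces T\<close>] by blast
    then have "norm (x - b) < L" using short[OF pair] \<open>f \<in> faces T\<close> \<open>x \<in> f\<close> by blast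
    then show ?thesis using True le_less_trans[OF norm_ge_zero] by simp
  next
    case False
    then show ?thesis using short[OF pair] that by blast
  qed
  have vert: "\<exists>b c. {v, b, c} \<in> faces T" if v: "v \<in> verts T" for v
  proof -
    obtain f where f: "f \<in> faces T" "v \<in> f" using verts[OF v] by blast
    obtain b where "b \<in> f" "v \<noteq> b" using other[OF f(1)] by blast
    then show ?thesis using third[OF f] f(1) by metis
  qed
  have edge: "\<exists>c. {a, b, c} \<in> faces T" if ab: "(a, b) \<in> edges T" for a b
  proof -
    obtain f where f: "f \<in> faces T" "a \<in> f" "b \<in> f" using edges[OF ab] by blast
    have "a \<noteq> b" using fin(3) ab by (auto simp: irrefl_def)
    then show ?thesis using third[OF f] f(1) by metis
  qed
  show ?thesis
    by (rule well_shapedI[OF fin(1) vert edge face(1,3) dist pair])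
qed

section \<open>Weighted least squares\<close>

text \<open>Coefficients become vectors of a Euclidean space, and evaluation at \<open>x\<close>
  becomes the inner product with \<open>(1, x)\<close>; fitting is then linear algebra.\<close>

lemma Pi1_eq_range: "Pi1 = range (\<lambda>(c :: real \<times> point) x. c \<bullet> (1, x))"
proof (intro set_eqI iffI)
  fix p assume "p \<in> Pi1"
  then obtain a b c where p: "\<And>x. p x = a + b * x $ 1 + c * x $ 2" by (auto simp: Pi1_def)
  have "p = (\<lambda>x. (a, vector [b, c] :: point) \<bullet> (1, x))"
    by (simp add: p fun_eq_iff inner_prod_def inner_vec_def sum_2)
  then show "p \<in> range (\<lambda>(c :: real \<times> point) x. c \<bullet> (1, x))" by blast
next
  fix p assume "p \<in> range (\<lambda>(c :: real \<times> point) x. c \<bullet> (1, x))"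
  then obtain c :: "real \<times> point" where "p = (\<lambda>x. c \<bullet> (1, x))" by blast
  moreover obtain a b where "c = (a, b)" by (cases c)
  ultimately have "p = (\<lambda>x. (a, b) \<bullet> (1, x))" by simp
  then have "\<forall>x. p x = a + b $ 1 * x $ 1 + b $ 2 * x $ 2"
    by (simp add: inner_prod_def inner_vec_def sum_2)
  then show "p \<in> Pi1" unfolding Pi1_def by blast
qed

text \<open>With nonzero gradient \<open>b\<close> the zero set would be a line, which cannot
  contain \<open>S\<close>. Once \<open>b\<close> is zero, any point of \<open>S\<close> forces the
  constant to vanish.\<close>

lemma affine_vanishing_noncollinear:
  fixes c :: "real \<times> point"
  assumes "\<not> collinear S" "\<And>u. u \<in> S \<Longrightarrow> c \<bullet> (1, u) = 0"
  shows "c = 0"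
proof -
  obtain a b where c: "c = (a, b)" by (cases c)
  have S: "S \<subseteq> {u. b \<bullet> u = - a}"
    using assms(2) by (force simp: c inner_prod_def)
  have b: "b = 0"
  proof (rule ccontr)
    assume "b \<noteq> 0"
    then have "aff_dim S \<le> 1"
      using aff_dim_subset[OF S] by (simp add: aff_dim_hyperplane)
    then show False using assms(1) by (simp add: collinear_aff_dim)
  qed
  have "S \<noteq> {}" using assms(1) by auto
  then have "a = 0" using S b by auto
  then show ?thesis using b c by (simp add: zero_prod_def)
qed

text \<open>Noncollinearity makes the Gram operator of the normal equations invertible, so the
  minimizer is unique and linear in \<open>z\<close>. Data sampled from an affine function are
  fitted exactly.\<close>

lemma least_squares_linear:
  fixes w :: "point \<Rightarrow> real"
  assumes "finite B" "\<And>u. u \<in> B \<Longrightarrow> w u > 0" "\<not> collinear B"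
  obtains \<alpha> where
    "\<And>z. arg_min (\<lambda>p. \<Sum>u\<in>B. w u * (p u - z u)\<^sup>2) (\<lambda>p. p \<in> Pi1) v = (\<Sum>u\<in>B. \<alpha> u * z u)"
    "\<And>p. p \<in> Pi1 \<Longrightarrow> (\<Sum>u\<in>B. \<alpha> u * p u) = p v"
proof -
  \<comment> \<open>\<open>A z\<close> is the right-hand side of the normal equations and
    \<open>G\<close> their Gram operator: the best coefficients solve
    \<open>G c = A z\<close>.\<close>
  define A where "A z = (\<Sum>u\<in>B. (w u * z u) *\<^sub>R (1 :: real, u))" for z
  define G where "G c = A (\<lambda>u. c \<bullet> (1, u))" for c :: "real \<times> point"
  have A_inner: "A z \<bullet> d = (\<Sum>u\<in>B. w u * (z u * (d \<bullet> (1, u))))" for z d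
    unfolding A_def inner_sum_left inner_scaleR_left
    by (intro sum.cong refl) (simp only: inner_commute[of _ d] mult.assoc)
  have pos: "d = 0" if "(\<Sum>u\<in>B. w u * (d \<bullet> (1, u))\<^sup>2) \<le> 0" for d :: "real \<times> point"
  proof (rule affine_vanishing_noncollinear[OF assms(3)])
    fix u assume u: "u \<in> B"
    have "(\<Sum>u\<in>B. w u * (d \<bullet> (1, u))\<^sup>2) = 0"
      using that assms(2) by (intro antisym sum_nonneg) (auto simp: less_imp_le)
    then have "w u * (d \<bullet> (1, u))\<^sup>2 = 0"
      using u assms(1,2) by (subst (asm) sum_nonneg_eq_0_iff) (auto simp: less_imp_le)
    then show "d \<bullet> (1, u) = 0" using assms(2)[OF u] by simp
  qed
  have "linear G"
    unfolding G_def A_def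
    by (intro linearI)
      (simp_all only: inner_add_left distrib_left scaleR_add_left sum.distrib
        inner_scaleR_left scaleR_sum_right scaleR_scaleR mult.left_commute)
  moreover have "inj G"
  proof (subst linear_injective_0[OF \<open>linear G\<close>], intro allI impI)
    fix c assume "G c = 0"
    then have "(\<Sum>u\<in>B. w u * (c \<bullet> (1, u))\<^sup>2) = 0"
      using A_inner[of "\<lambda>u. c \<bullet> (1, u)" c] by (simp add: G_def power2_eq_square)
    then show "c = 0" using pos by simp
  qed
  ultimately obtain H where H: "linear H" "\<And>c. H (G c) = c" "\<And>c. G (H c) = c"
    using linear_injective_isomorphism by blast
  let ?E = "\<lambda>z p. \<Sum>u\<in>B. w u * (p u - z u)\<^sup>2"
  let ?P = "\<lambda>c x. c \<bullet> (1 :: real, x :: point)"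
  \<comment> \<open>Pythagoras: at the solution of the normal equations the residual is orthogonal
    to all affine functions, so the cross term vanishes.\<close>
  have E: "?E z (?P (H (A z) + d)) = ?E z (?P (H (A z))) + (\<Sum>u\<in>B. w u * (d \<bullet> (1, u))\<^sup>2)" for z d
  proof -
    let ?c = "H (A z)"
    have "(\<Sum>u\<in>B. w u * ((?c \<bullet> (1, u)) * (d \<bullet> (1, u)))) = A z \<bullet> d"
      using A_inner[of "\<lambda>u. ?c \<bullet> (1, u)" d] H(3)[of "A z"] by (simp add: G_def)
    then have "(\<Sum>u\<in>B. w u * ((?c \<bullet> (1, u) - z u) * (d \<bullet> (1, u)))) = 0"
      by (simp add: A_inner left_diff_distrib right_diff_distrib sum_subtractf)
    moreover have "?E z (?P (?c + d)) = ?E z (?P ?c)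
        + 2 * (\<Sum>u\<in>B. w u * ((?c \<bullet> (1, u) - z u) * (d \<bullet> (1, u))))
        + (\<Sum>u\<in>B. w u * (d \<bullet> (1, u))\<^sup>2)"
      by (simp add: inner_add_left sum_distrib_left power2_eq_square algebra_simps
          flip: sum.distrib)
    ultimately show ?thesis by simp
  qed
  have argmin: "arg_min (?E z) (\<lambda>p. p \<in> Pi1) = ?P (H (A z))" for z
  proof -
    let ?c = "H (A z)"
    have "is_arg_min (?E z) (\<lambda>p. p \<in> Pi1) (?P ?c)"
    proof -
      have "?E z (?P ?c) \<le> ?E z (?P e)" for e
      proof -
        have "0 \<le> (\<Sum>u\<in>B. w u * ((e - ?c) \<bullet> (1, u))\<^sup>2)"
          using assms(2) by (intro sum_nonneg) (auto simp: less_imp_le)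
        then show ?thesis using E[of z "e - ?c"] by simp
      qed
      then show ?thesis by (auto simp: is_arg_min_linorder Pi1_eq_range)
    qed
    \<comment> \<open>\<open>arg_min\<close> picks some minimizer, so its value is determined only
      through uniqueness.\<close>
    moreover have "p = ?P ?c" if p: "is_arg_min (?E z) (\<lambda>p. p \<in> Pi1) p" for p
    proof -
      obtain e where e: "p = ?P e"
        using p unfolding is_arg_min_def Pi1_eq_range by blast
      have "?E z p \<le> ?E z (?P ?c)"
        using p by (auto simp: is_arg_min_linorder Pi1_eq_range)
      then have "(\<Sum>u\<in>B. w u * ((e - ?c) \<bullet> (1, u))\<^sup>2) \<le> 0"
        using E[of z "e - ?c"] by (simp add: e)
      then have "e - ?c = 0" by (rule pos)
      then show ?thesis using e by simp
    qed
    ultimately show ?thesis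
      unfolding arg_min_def by (rule some_equality)
  qed
  \<comment> \<open>Expanding \<open>H (A z)\<close> by linearity and evaluating at
    \<open>v\<close>, that is, pairing with \<open>(1, v)\<close>, isolates the coefficient of
    \<open>z u\<close>.\<close>
  define \<alpha> where "\<alpha> u = w u * (H (1, u) \<bullet> (1, v))" for u
  have \<alpha>: "(\<Sum>u\<in>B. \<alpha> u * z u) = H (A z) \<bullet> (1, v)" for z
    unfolding A_def \<alpha>_def linear_sum[OF H(1)] linear_cmul[OF H(1)] inner_sum_left
      inner_scaleR_left
    by (intro sum.cong refl) (simp only: mult_ac)
  show ?thesis
  proof (rule that[of \<alpha>])
    show "arg_min (?E z) (\<lambda>p. p \<in> Pi1) v = (\<Sum>u\<in>B. \<alpha> u * z u)" for z
      by (simp only: argmin \<alpha>)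
    show "(\<Sum>u\<in>B. \<alpha> u * p u) = p v" if "p \<in> Pi1" for p
    proof -
      obtain c where c: "p = ?P c" using \<open>p \<in> Pi1\<close> unfolding Pi1_eq_range by blast
      have "H (A p) = c" using H(2)[of c] by (simp add: G_def c)
      then show ?thesis by (simp only: \<alpha>) (simp add: c)
    qed
  qed
qed

section \<open>The subdivision operators\<close>

text \<open>The strict ball inequality puts each weight argument into \<open>{0..<1}\<close>, where
  \<open>W\<close> is positive, and a whole coarse face inside the ball rules out
  collinearity.\<close>

lemma subdiv_op_linear:
  assumes T0: "well_shaped L T0" and W: "W \<in> {0..<1} \<rightarrow> {0<..1}"
    and v: "v \<in> verts (mesh_level T0 (Suc k))"
  obtains \<alpha> where
    "\<And>z. subdiv_op T0 L W k z v = (\<Sum>u\<in>ls_ball T0 L k v. \<alpha> u * z u)"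
    "\<And>p. p \<in> Pi1 \<Longrightarrow> (\<Sum>u\<in>ls_ball T0 L k v. \<alpha> u * p u) = p v"
proof -
  let ?B = "ls_ball T0 L k v"
  note T = well_shaped_mesh_level[OF T0, of k]
  have "finite ?B" using well_shapedD(1)[OF T] by (simp add: ls_ball_def)
  moreover have "ls_weight L W k v u > 0" if "u \<in> ?B" for u
  proof -
    have *: "norm (v - u) < L / 2 ^ k" using that by (simp add: ls_ball_def norm_minus_commute)
    then have "norm (v - u) / (L / 2 ^ k) < 1"
      using norm_ge_zero[of "v - u"] by (subst divide_less_eq_1_pos) linarith+
    moreover have "0 \<le> norm (v - u) / (L / 2 ^ k)"
      using order_trans[OF norm_ge_zero less_imp_le[OF *]] by (rule divide_nonneg_nonneg[OF norm_ge_zero])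
    ultimately have "norm (v - u) / (L / 2 ^ k) \<in> {0..<1}" by simp
    from funcset_mem[OF W this] show ?thesis by (simp add: ls_weight_def)
  qed
  moreover have "\<not> collinear ?B"
  proof -
    obtain f where f: "f \<in> faces (mesh_level T0 k)" "\<And>u. u \<in> f \<Longrightarrow> norm (u - v) < L / 2 ^ k"
      using refine_vertex_near_face[OF T] v by auto
    then have "f \<subseteq> ?B" using well_shapedD(4)[OF T f(1)] by (auto simp: ls_ball_def)
    then show ?thesis using well_shapedD(5)[OF T f(1)] collinear_subset by blast
  qed
  ultimately show ?thesis
  proof (rule least_squares_linear[where v = v])
    fix \<alpha>
    assume
      "\<And>z. arg_min (\<lambda>p. \<Sum>u\<in>?B. ls_weight L W k v u * (p u - z u)\<^sup>2) (\<lambda>p. p \<in> Pi1) v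
        = (\<Sum>u\<in>?B. \<alpha> u * z u)"
      "\<And>p. p \<in> Pi1 \<Longrightarrow> (\<Sum>u\<in>?B. \<alpha> u * p u) = p v"
    then show thesis
      by (intro that[of \<alpha>]) (simp_all add: subdiv_op_def ls_error_def[abs_def])
  qed
qed

text \<open>Linearity and affine reproduction both survive composition of levels. One \<beta> per
  level and vertex serves all data.\<close>

lemma subdiv_iter_linear:
  assumes T0: "well_shaped L T0" and W: "W \<in> {0..<1} \<rightarrow> {0<..1}"
    and "v \<in> verts (mesh_level T0 k)"
  shows "\<exists>\<beta>. (\<forall>z. subdiv_iter T0 L W k z v = (\<Sum>u\<in>verts T0. \<beta> u * z u)) \<and>
    (\<forall>p\<in>Pi1. (\<Sum>u\<in>verts T0. \<beta> u * p u) = p v)"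
  using assms(3)
proof (induction k arbitrary: v)
  case 0
  \<comment> \<open>Level 0 is the identity, whose coefficients at \<open>v\<close> form the unit
    vector of \<open>v\<close>.\<close>
  have "(\<Sum>u\<in>verts T0. (if u = v then 1 else 0) * z u) = z v" for z :: "point \<Rightarrow> real"
    using 0 well_shapedD(1)[OF T0] by (simp add: if_distrib[of "\<lambda>x. x * _"] sum.delta cong: if_cong)
  then show ?case by (intro exI[of _ "\<lambda>u. if u = v then 1 else 0"]) simp
next
  case (Suc k)
  let ?B = "ls_ball T0 L k v"
  obtain \<alpha> where \<alpha>:
    "\<And>z. subdiv_op T0 L W k z v = (\<Sum>u\<in>?B. \<alpha> u * z u)"
    "\<And>p. p \<in> Pi1 \<Longrightarrow> (\<Sum>u\<in>?B. \<alpha> u * p u) = p v"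
    using subdiv_op_linear[OF T0 W Suc.prems] by metis
  have "\<forall>u\<in>?B. \<exists>\<beta>. (\<forall>z. subdiv_iter T0 L W k z u = (\<Sum>x\<in>verts T0. \<beta> x * z x)) \<and>
    (\<forall>p\<in>Pi1. (\<Sum>x\<in>verts T0. \<beta> x * p x) = p u)"
    using Suc.IH by (simp add: ls_ball_def)
  then obtain \<beta> where \<beta>: "\<forall>u\<in>?B. (\<forall>z. subdiv_iter T0 L W k z u = (\<Sum>x\<in>verts T0. \<beta> u x * z x)) \<and>
    (\<forall>p\<in>Pi1. (\<Sum>x\<in>verts T0. \<beta> u x * p x) = p u)"
    by (rule bchoice[THEN exE]) blast
  \<comment> \<open>A row of a matrix product: the row \<alpha> of the last level times the rows
    \<beta> of the levels below.\<close>
  define \<gamma> where "\<gamma> x = (\<Sum>u\<in>?B. \<alpha> u * \<beta> u x)" for x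
  have \<gamma>: "(\<Sum>x\<in>verts T0. \<gamma> x * z x) = (\<Sum>u\<in>?B. \<alpha> u * (\<Sum>x\<in>verts T0. \<beta> u x * z x))" for z
    unfolding \<gamma>_def sum_distrib_left sum_distrib_right
    by (subst sum.swap) (simp add: mult.assoc)
  have "subdiv_iter T0 L W (Suc k) z v = (\<Sum>x\<in>verts T0. \<gamma> x * z x)" for z
    unfolding \<gamma> using \<beta> by (simp add: \<alpha>(1))
  moreover have "(\<Sum>x\<in>verts T0. \<gamma> x * p x) = p v" if "p \<in> Pi1" for p
    unfolding \<gamma> using \<beta> \<alpha>(2)[OF that] that by simp
  ultimately show ?case by blast
qed

text \<open>A convergent sequence is bounded, so all iterates, early ones included, stay within a
  fixed distance of \<open>G\<close>; and \<open>G\<close> is bounded on the compact hull containing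
  every level.\<close>

lemma subdiv_iter_bounded:
  assumes T0: "well_shaped L T0" and conv: "scheme_converges T0 L W z"
  obtains M where "\<And>k v. v \<in> verts (mesh_level T0 k) \<Longrightarrow> \<bar>subdiv_iter T0 L W k z v\<bar> \<le> M"
proof -
  let ?V = "\<lambda>k. verts (mesh_level T0 k)"
  obtain G where G: "continuous_on UNIV G"
    and lim: "(\<lambda>k. SUP v\<in>?V k. \<bar>subdiv_iter T0 L W k z v - G v\<bar>) \<longlonglongrightarrow> 0"
    using conv unfolding scheme_converges_def by blast
  obtain M1 where M1: "\<And>k. \<bar>SUP v\<in>?V k. \<bar>subdiv_iter T0 L W k z v - G v\<bar>\<bar> \<le> M1"
    using convergent_imp_Bseq[OF convergentI[OF lim]] unfolding Bseq_def real_norm_def by blast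
  have "compact (G ` (convex hull verts T0))"
    using well_shapedD(1)[OF T0] G
    by (intro compact_continuous_image finite_imp_compact_convex_hull)
      (auto intro: continuous_on_subset)
  then obtain M2 where M2: "\<And>x. x \<in> convex hull verts T0 \<Longrightarrow> \<bar>G x\<bar> \<le> M2"
    using compact_imp_bounded[of "G ` (convex hull verts T0)"] unfolding bounded_iff
    by (auto simp del: image_image)
  show ?thesis
  proof (rule that[of "M1 + M2"])
    fix k v assume v: "v \<in> ?V k"
    have "finite (?V k)" using well_shapedD(1)[OF well_shaped_mesh_level[OF T0]] .
    then have "\<bar>subdiv_iter T0 L W k z v - G v\<bar> \<le> (SUP v\<in>?V k. \<bar>subdiv_iter T0 L W k z v - G v\<bar>)"
      using v by (intro cSUP_upper bdd_above_finite) auto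
    then have "\<bar>subdiv_iter T0 L W k z v - G v\<bar> \<le> M1" using M1[of k] by linarith
    moreover have "\<bar>G v\<bar> \<le> M2" using M2 verts_mesh_level_hull[OF T0] v by blast
    ultimately show "\<bar>subdiv_iter T0 L W k z v\<bar> \<le> M1 + M2" by linarith
  qed
qed

text \<open>A uniform boundedness principle in finite dimension: the cardinal data of the initial
  vertices span all data, and convergence for each of them bounds its coefficient uniformly in
  \<open>k\<close> and \<open>v\<close>.\<close>

lemma subdiv_iter_stable:
  assumes T0: "well_shaped L T0" and W: "W \<in> {0..<1} \<rightarrow> {0<..1}"
    and conv: "\<And>z. scheme_converges T0 L W z"
  obtains M where "\<And>k v z e. v \<in> verts (mesh_level T0 k) \<Longrightarrow>
    (\<And>u. u \<in> verts T0 \<Longrightarrow> \<bar>z u\<bar> \<le> e) \<Longrightarrow> \<bar>subdiv_iter T0 L W k z v\<bar> \<le> M * e"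
proof -
  define \<delta> :: "point \<Rightarrow> point \<Rightarrow> real" where "\<delta> u x = (if x = u then 1 else 0)" for u x
  have "\<forall>u. \<exists>m. \<forall>k. \<forall>v\<in>verts (mesh_level T0 k). \<bar>subdiv_iter T0 L W k (\<delta> u) v\<bar> \<le> m"
    using subdiv_iter_bounded[OF T0 conv] by metis
  then obtain m where
    m: "\<And>u k v. v \<in> verts (mesh_level T0 k) \<Longrightarrow> \<bar>subdiv_iter T0 L W k (\<delta> u) v\<bar> \<le> m u"
    by metis
  show ?thesis
  proof (rule that[of "\<Sum>u\<in>verts T0. m u"])
    fix k v z and e :: real
    assume v: "v \<in> verts (mesh_level T0 k)" and z: "\<And>u. u \<in> verts T0 \<Longrightarrow> \<bar>z u\<bar> \<le> e"
    obtain \<beta> where \<beta>: "\<And>z. subdiv_iter T0 L W k z v = (\<Sum>u\<in>verts T0. \<beta> u * z u)"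
      using subdiv_iter_linear[OF T0 W v] by blast
    have \<beta>m: "\<bar>\<beta> u\<bar> \<le> m u" if "u \<in> verts T0" for u
    proof -
      \<comment> \<open>The response to the cardinal data of \<open>u\<close> is exactly the
        coefficient at \<open>u\<close>.\<close>
      have "subdiv_iter T0 L W k (\<delta> u) v = \<beta> u"
        using that well_shapedD(1)[OF T0]
        by (simp add: \<beta> \<delta>_def if_distrib[of "\<lambda>x. _ * x"] sum.delta cong: if_cong)
      then show ?thesis using m[OF v, of u] by simp
    qed
    have "\<bar>subdiv_iter T0 L W k z v\<bar> \<le> (\<Sum>u\<in>verts T0. \<bar>\<beta> u\<bar> * \<bar>z u\<bar>)"
      unfolding \<beta> by (rule order_trans[OF sum_abs]) (simp add: abs_mult)
    also have "\<dots> \<le> (\<Sum>u\<in>verts T0. m u * e)"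
    proof (intro sum_mono mult_mono)
      show "0 \<le> m u" if "u \<in> verts T0" for u using \<beta>m[OF that] by linarith
    qed (use \<beta>m z in auto)
    finally show "\<bar>subdiv_iter T0 L W k z v\<bar> \<le> (\<Sum>u\<in>verts T0. m u) * e"
      by (simp add: sum_distrib_right)
  qed
qed

section \<open>Approximation order\<close>

text \<open>The mean value inequality is applied twice: the bound on \<open>F''\<close> makes
  \<open>F'\<close> Lipschitz, and this in turn controls the Taylor remainder.\<close>

lemma C2_bounded_derivs_taylor:
  assumes "C2_bounded_derivs F"
  obtains F' :: "point \<Rightarrow> point \<Rightarrow>\<^sub>L real" and K where "0 \<le> K"
    "\<And>x y. \<bar>F y - (F x + F' x (y - x))\<bar> \<le> K * (norm (y - x))\<^sup>2"
proof -
  obtain F' :: "point \<Rightarrow> point \<Rightarrow>\<^sub>L real" and F'' :: "point \<Rightarrow> point \<Rightarrow>\<^sub>L point \<Rightarrow>\<^sub>L real"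
    where F': "\<And>x. (F has_derivative blinfun_apply (F' x)) (at x)"
      and F'': "\<And>x. (F' has_derivative blinfun_apply (F'' x)) (at x)"
      and "bounded (range F'')"
    using assms unfolding C2_bounded_derivs_def by blast
  then obtain K where K: "\<And>x. norm (F'' x) \<le> K" unfolding bounded_iff by auto
  have lip: "norm (F' y - F' x) \<le> K * norm (y - x)" for x y
    by (rule differentiable_bound[of UNIV F' "\<lambda>x. blinfun_apply (F'' x)"])
      (use F'' K in \<open>auto simp: norm_blinfun.rep_eq[symmetric]\<close>)
  have "0 \<le> K" using K[of 0] norm_ge_zero order_trans by blast
  moreover have "\<bar>F y - (F x + F' x (y - x))\<bar> \<le> K * (norm (y - x))\<^sup>2" for x y
  proof -
    let ?S = "closed_segment x y"
    \<comment> \<open>Subtracting the linear map \<open>F' x\<close> leaves the derivative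
      \<open>F' s - F' x\<close>, which is small along the segment. Bounding it by its largest value
      gives the constant \<open>K\<close> instead of the sharper \<open>K / 2\<close>.\<close>
    have "norm ((F y - F' x y) - (F x - F' x x)) \<le> (K * norm (y - x)) * norm (y - x)"
    proof (rule differentiable_bound[of ?S "\<lambda>s. F s - F' x s" "\<lambda>s. blinfun_apply (F' s - F' x)"])
      fix s assume s: "s \<in> ?S"
      show "((\<lambda>s. F s - F' x s) has_derivative blinfun_apply (F' s - F' x)) (at s within ?S)"
        by (rule has_derivative_eq_rhs,
            rule has_derivative_diff[OF has_derivative_at_withinI[OF F']
              bounded_linear_imp_has_derivative[OF blinfun.bounded_linear_right]])
          (simp add: blinfun.diff_left fun_eq_iff)
      have "norm (F' s - F' x) \<le> K * norm (s - x)" by (rule lip)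
      also have "\<dots> \<le> K * norm (y - x)"
        using segment_bound1[OF s] \<open>0 \<le> K\<close> by (intro mult_left_mono) (auto simp: norm_minus_commute)
      finally show "onorm (blinfun_apply (F' s - F' x)) \<le> K * norm (y - x)"
        by (simp add: norm_blinfun.rep_eq)
    qed auto
    then show ?thesis
      by (simp add: blinfun.diff_right power2_eq_square algebra_simps)
  qed
  ultimately show ?thesis using that by blast
qed

lemma affine_in_Pi1:
  fixes l :: "point \<Rightarrow>\<^sub>L real"
  shows "(\<lambda>x. a + l (h *\<^sub>R x - y)) \<in> Pi1"
proof -
  have l: "l x = l (axis 1 1) * x $ 1 + l (axis 2 1) * x $ 2" for x
  proof -
    have "x = x $ 1 *\<^sub>R axis 1 1 + x $ 2 *\<^sub>R axis 2 1"
      by (simp add: vec_eq_iff forall_2 axis_def)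
    then have "l x = l (x $ 1 *\<^sub>R axis 1 1 + x $ 2 *\<^sub>R axis 2 1)" by simp
    then show ?thesis by (simp add: blinfun.add_right blinfun.scaleR_right)
  qed
  have "a + l (h *\<^sub>R x - y)
      = (a - l y) + (h * l (axis 1 1)) * x $ 1 + (h * l (axis 2 1)) * x $ 2" for x
  proof -
    have "a + l (h *\<^sub>R x - y) = (a - l y) + h * l x"
      by (simp add: blinfun.diff_right blinfun.scaleR_right)
    then show ?thesis
      by (subst (asm) (2) l) (simp add: distrib_left)
  qed
  then show ?thesis unfolding Pi1_def by blast
qed

theorem proposition4p2:
  fixes T0 :: mesh and L :: real and W :: "real \<Rightarrow> real" and F :: "point \<Rightarrow> real"
  assumes "plane_triangulation T0"
    and "L > (SUP (a, b)\<in>edges T0. norm (a - b))"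
    and "W \<in> {0..<1} \<rightarrow> {0<..1}"
    and "C2_bounded_derivs F"
    and "\<And>z0. scheme_converges T0 L W z0"
  shows "\<exists>C1>0. \<exists>h0>0. \<forall>h. 0 < h \<and> h < h0 \<longrightarrow> (\<forall>k.
           max_norm (verts (mesh_level T0 (Suc k)))
             (\<lambda>v. subdiv_iter T0 L W (Suc k) (scaled_data F h) v - scaled_data F h v)
           \<le> C1 * h\<^sup>2)"
proof -
  let ?V = "\<lambda>k. verts (mesh_level T0 k)"
  have T0: "well_shaped L T0"
    using assms(1,2) by (rule well_shaped_plane_triangulation)
  obtain M where M: "\<And>k v z e. v \<in> ?V k \<Longrightarrow>
    (\<And>u. u \<in> verts T0 \<Longrightarrow> \<bar>z u\<bar> \<le> e) \<Longrightarrow> \<bar>subdiv_iter T0 L W k z v\<bar> \<le> M * e"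
    using subdiv_iter_stable[OF T0 assms(3,5)] by blast
  obtain F' :: "point \<Rightarrow> point \<Rightarrow>\<^sub>L real" and K where K: "0 \<le> K"
    and taylor: "\<And>x y. \<bar>F y - (F x + F' x (y - x))\<bar> \<le> K * (norm (y - x))\<^sup>2"
    using C2_bounded_derivs_taylor[OF assms(4)] by metis
  \<comment> \<open>All levels lie in this hull, so \<open>D\<close> bounds the distance from any
    refined vertex to any initial vertex, uniformly in \<open>k\<close>.\<close>
  define D where "D = diameter (convex hull verts T0)"
  have D: "norm (x - y) \<le> D" if "x \<in> convex hull verts T0" "y \<in> convex hull verts T0" for x y
    unfolding D_def using that well_shapedD(1)[OF T0]
    by (metis bounded_convex_hull diameter_bounded_bound dist_norm finite_imp_bounded)
  have err: "\<bar>subdiv_iter T0 L W k (scaled_data F h) v - scaled_data F h v\<bar> \<le> M * (K * D\<^sup>2 * h\<^sup>2)"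
    if "0 < h" "v \<in> ?V k" for h k v
  proof -
    \<comment> \<open>The Taylor polynomial of \<open>F\<close> at the scaled evaluation point, read
      as a function of the unscaled vertex \<open>u\<close>; at \<open>v\<close> it agrees with the
      scaled data.\<close>
    define p where "p u = F (h *\<^sub>R v) + F' (h *\<^sub>R v) (h *\<^sub>R u - h *\<^sub>R v)" for u
    have p: "p \<in> Pi1" unfolding p_def by (rule affine_in_Pi1)
    obtain \<beta> where \<beta>: "\<And>z. subdiv_iter T0 L W k z v = (\<Sum>u\<in>verts T0. \<beta> u * z u)"
      "(\<Sum>u\<in>verts T0. \<beta> u * p u) = p v"
      using subdiv_iter_linear[OF T0 assms(3) \<open>v \<in> ?V k\<close>] p by metis
    \<comment> \<open>By reproduction of \<open>p\<close> the error is the iterate of the Taylor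
      remainder, to which stability applies.\<close>
    have "subdiv_iter T0 L W k (scaled_data F h) v - scaled_data F h v
        = subdiv_iter T0 L W k (\<lambda>u. scaled_data F h u - p u) v"
      unfolding \<beta>(1) right_diff_distrib sum_subtractf \<beta>(2)
      by (simp add: p_def scaled_data_def)
    moreover have "\<bar>scaled_data F h u - p u\<bar> \<le> K * D\<^sup>2 * h\<^sup>2" if u: "u \<in> verts T0" for u
    proof -
      have "v \<in> convex hull verts T0" using verts_mesh_level_hull[OF T0] \<open>v \<in> ?V k\<close> by blast
      then have uv: "norm (u - v) \<le> D" using D u by (simp add: hull_inc)
      have "\<bar>scaled_data F h u - p u\<bar> \<le> K * (norm (h *\<^sub>R u - h *\<^sub>R v))\<^sup>2"
        unfolding scaled_data_def p_def by (rule taylor)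
      also have "\<dots> = K * (norm (u - v))\<^sup>2 * h\<^sup>2"
        by (simp add: power_mult_distrib flip: scaleR_diff_right)
      also have "\<dots> \<le> K * D\<^sup>2 * h\<^sup>2"
        using uv K by (intro mult_right_mono mult_left_mono power_mono) auto
      finally show ?thesis .
    qed
    ultimately show ?thesis using M[OF that(2)] by simp
  qed
  \<comment> \<open>The sign of \<open>M\<close> is not recorded, hence the absolute value; adding
    one makes \<open>C\<close> positive.\<close>
  define C where "C = \<bar>M * (K * D\<^sup>2)\<bar> + 1"
  have "max_norm (?V (Suc k))
      (\<lambda>v. subdiv_iter T0 L W (Suc k) (scaled_data F h) v - scaled_data F h v) \<le> C * h\<^sup>2"
    if "0 < h" for h k
  proof -
    have "?V (Suc k) \<noteq> {}"
      using assms(1) by (induction k) (auto simp: plane_triangulation_def refine_def)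
    moreover have "finite (?V (Suc k))"
      using well_shapedD(1)[OF well_shaped_mesh_level[OF T0]] .
    moreover have "M * (K * D\<^sup>2 * h\<^sup>2) \<le> C * h\<^sup>2"
    proof -
      have "M * (K * D\<^sup>2) * h\<^sup>2 \<le> C * h\<^sup>2" by (intro mult_right_mono) (auto simp: C_def)
      then show ?thesis by (simp add: mult.assoc)
    qed
    ultimately show ?thesis
      unfolding max_norm_def using err[OF that, of _ "Suc k"]
      by (subst Max_le_iff) (auto intro: order_trans simp del: mesh_level.simps subdiv_iter.simps)
  qed
  moreover have "C > 0" by (simp add: C_def)
  \<comment> \<open>The estimate holds for every positive \<open>h\<close>, so \<open>h0\<close> may
    be taken as 1.\<close>
  ultimately show ?thesis using zero_less_one by blast
qed

end
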